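(* Let $n\ge 1$, let $S:\{0,1\}^n\to\{0,1\}^n$ be a Boolean model on $X=\{0,1\}^n$, and let $\mathcal{P}$ be a set of non-empty subsets of $\{1,\dots,n\}$ whose union is $\{1,\dots,n\}$. If the regulatory graph $\mathcal{RG}(S)$ does not contain any circuit, then the $\mathcal{P}$-asynchronous dynamics defined by $S$ is simple. Moreover, for any $x\in X$, there exists in the state transition graph $\mathrm{STG}_{\mathcal{P}}$ a path of length at most $n$ from $x$ to the single fixed point of $S$.
   Context: A Boolean model is a map $S=(S_1,\dots,S_n): X=\{0,1\}^n\to X$, with $n$ an integer $>0$; elements of $X$ are called states. For $x\in X$ and a non-empty subset $J\subseteq\{1,\dots,n\}$, $\overline{x}^{J}$ denotes the state obtained from $x$ by switching ($0\leftrightarrow 1$) the coordinates with index in $J$; write $\overline{x}^{i}=\overline{x}^{\{i\}}$. Regulatory graph: $\mathcal{RG}(S)$ is the directed graph with vertices $g_1,\dots,g_n$ and an edge from $g_i$ to $g_j$ (possibly $i=j$) if and only if there exists $x\in X$ such that $S_j(x)\neq S_j(\overline{x}^{i})$. A circuit is a directed cycle of this graph (a loop $g_i\to g_i$ counts as a circuit). Updating set: $Upd_S(x)=\{i\in\{1,\dots,n\} : S_i(x)\neq x_i\}$. $\mathcal{P}$-asynchronous dynamics: its state transition graph $\mathrm{STG}_{\mathcal{P}}$ is the directed graph with vertex set $X$ whose edges with origin $x$ are exactly those going from $x$ to $\overline{x}^{J\cap Upd_S(x)}$, where $J$ is any element of $\mathcal{P}$ such that $J\cap Upd_S(x)\neq\emptyset$.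 The trajectories of the dynamics are the paths of this graph. Simple: a dynamics (and its state transition graph) is called simple if the graph has only one attractor, i.e. only one terminal strongly connected component (one with no edge leaving it), and this attractor is reduced to a single state. By a known theorem of Robert, if $\mathcal{RG}(S)$ contains no circuit then $S$ has exactly one fixed point; this is "the single fixed point of $S$". *)

theory Defs
  imports "HOL-Library.Cardinality" "Graph_Theory.Graph_Theory"
begin

text \<open>
  The index set \<open>{1,\<dots>,n}\<close> is an arbitrary finite type \<open>'n\<close> with \<open>n = CARD('n)\<close>; such a type is
  nonempty, so \<open>n \<ge> 1\<close>. States of \<open>{0,1}\<^sup>n\<close> are functions \<open>'n \<Rightarrow> bool\<close>, with \<open>True\<close> for \<open>1\<close>.
\<close>

type_synonym 'n state = "'n \<Rightarrow> bool"

type_synonym 'n boolean_model = "'n state \<Rightarrow> 'n state"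

definition switch :: "'n state \<Rightarrow> 'n set \<Rightarrow> 'n state" where
  "switch x J = (\<lambda>i. if i \<in> J then \<not> x i else x i)"

text \<open>The vertex \<open>g\<^sub>i\<close> is represented by the index \<open>i\<close> itself.\<close>

definition regulatory_graph :: "'n boolean_model \<Rightarrow> 'n pair_pre_digraph" where
  "regulatory_graph S =
     \<lparr> pverts = UNIV, parcs = {(i, j). \<exists>x. S x j \<noteq> S (switch x {i}) j} \<rparr>"

definition Upd :: "'n boolean_model \<Rightarrow> 'n state \<Rightarrow> 'n set" where
  "Upd S x = {i. S x i \<noteq> x i}"

definition STG :: "'n set set \<Rightarrow> 'n boolean_model \<Rightarrow> 'n state pair_pre_digraph" where
  "STG P S =
     \<lparr> pverts = UNIV,
       parcs = {(x, switch x (J \<inter> Upd S x)) | x J. J \<in> P \<and> J \<inter> Upd S x \<noteq> {}} \<rparr>"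

definition attractors :: "'a pair_pre_digraph \<Rightarrow> 'a set set" where
  "attractors G =
     {A \<in> pre_digraph.sccs_verts (with_proj G). \<forall>(u, v) \<in> parcs G. u \<in> A \<longrightarrow> v \<in> A}"

definition simple_dynamics :: "'a pair_pre_digraph \<Rightarrow> bool" where
  "simple_dynamics G \<longleftrightarrow> (\<exists>a. attractors G = {{a}})"

end

theory Submission
  imports Defs
begin

text \<open>
  Call a coordinate settled at \<open>x\<close> if neither it nor any of its ancestors in the regulatory graph
  is in the updating set of \<open>x\<close>. Settled coordinates stay settled along every transition. If \<open>x\<close>
  is not fixed, acyclicity yields \<open>k \<in> Upd S x\<close> none of whose proper ancestors is in the updating
  set, and every transition that updates \<open>k\<close> settles it. So at most \<open>n\<close> transitions lead to a
  fixed point. The same choice of a minimal coordinate, applied to the difference of two fixed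
  points, gives uniqueness.
\<close>

definition settled :: "'n boolean_model \<Rightarrow> 'n state \<Rightarrow> 'n set" where
  "settled S x = {i. \<forall>j. (j, i) \<in> (parcs (regulatory_graph S))\<^sup>* \<longrightarrow> j \<notin> Upd S x}"

lemma in_parcs_regulatory_graph:
  "(i, j) \<in> parcs (regulatory_graph S) \<longleftrightarrow> (\<exists>x. S x j \<noteq> S (switch x {i}) j)"
  by (simp add: regulatory_graph_def)

lemma in_parcs_STG:
  "(x, y) \<in> parcs (STG P S) \<longleftrightarrow>
    (\<exists>J\<in>P. J \<inter> Upd S x \<noteq> {} \<and> y = switch x (J \<inter> Upd S x))"
  by (auto simp: STG_def)

lemma Upd_empty_iff: "Upd S x = {} \<longleftrightarrow> S x = x"
  by (auto simp: Upd_def fun_eq_iff)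

lemma wf_digraph_regulatory_graph: "wf_digraph (with_proj (regulatory_graph S))"
  by unfold_locales (auto simp: regulatory_graph_def)

lemma wf_digraph_STG: "wf_digraph (with_proj (STG P S))"
  by unfold_locales (auto simp: STG_def)

text \<open>A missing edge \<open>(i, k)\<close> speaks only of switching \<open>i\<close> alone, at
  any state. So the elements of \<open>D\<close> are switched one after another.\<close>

lemma model_switch_irrelevant:
  assumes "finite D" and "\<And>i. i \<in> D \<Longrightarrow> (i, k) \<notin> parcs (regulatory_graph S)"
  shows "S (switch x D) k = S x k"
  using assms
proof (induction D rule: finite_induct)
  case empty
  then show ?case by (simp add: switch_def)
next
  case (insert i D)
  have "switch x (insert i D) = switch (switch x D) {i}"
    using insert.hyps by (auto simp: switch_def fun_eq_iff)
  moreover have "S (switch x D) k = S (switch (switch x D) {i}) k"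
    using insert.prems[of i] by (auto simp: in_parcs_regulatory_graph)
  ultimately show ?case
    using insert by simp
qed

text \<open>Switching \<open>x\<close> exactly where it differs from \<open>y\<close> yields
  \<open>y\<close>, and no regulator of \<open>k\<close> is switched.\<close>

lemma model_eq_if_agree_on_regulators:
  fixes S :: "'n::finite boolean_model"
  assumes "\<And>i. (i, k) \<in> parcs (regulatory_graph S) \<Longrightarrow> x i = y i"
  shows "S x k = S y k"
proof -
  have "switch x {i. x i \<noteq> y i} = y"
    by (auto simp: switch_def fun_eq_iff)
  moreover have "S (switch x {i. x i \<noteq> y i}) k = S x k"
    using assms by (intro model_switch_irrelevant) auto
  ultimately show ?thesis by simp
qed

text \<open>A nonempty closed walk contains a cycle, a loop being a cycle of length one.\<close>

lemma wf_digraph_acyclic: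
  assumes "wf_digraph (with_proj G)" and "\<nexists>p. pre_digraph.cycle (with_proj G) p"
  shows "acyclic (parcs G)"
proof (rule acyclicI, rule allI, rule notI)
  interpret wf_digraph "with_proj G" by fact
  fix u assume "(u, u) \<in> (parcs G)\<^sup>+"
  then obtain p where "awalk u p u" "p \<noteq> []"
    using reachable1_awalk[of u u] by auto
  then show False
    using closed_w_imp_cycle assms(2) by (auto simp: closed_w_def)
qed

text \<open>An acyclic relation on a finite type is well-founded. Minimality is taken for the
  transitive closure, to exclude all proper ancestors and not only direct regulators.\<close>

lemma acyclic_ancestor_minimal:
  fixes E :: "'n::finite rel"
  assumes "acyclic E" and "D \<noteq> {}"
  obtains k where "k \<in> D" and "\<And>j. (j, k) \<in> E\<^sup>+ \<Longrightarrow> j \<notin> D"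
proof -
  have "wf (E\<^sup>+)"
    using assms(1) by (intro wf_trancl finite_acyclic_wf) auto
  then show ?thesis
    using assms(2) that by (meson wfE_min ex_in_conv)
qed

lemma fixed_point_unique:
  fixes S :: "'n::finite boolean_model"
  assumes "acyclic (parcs (regulatory_graph S))" and "S a = a" and "S b = b"
  shows "a = b"
proof (rule ccontr)
  assume "a \<noteq> b"
  then have "{i. a i \<noteq> b i} \<noteq> {}" by (auto simp: fun_eq_iff)
  with assms(1) obtain k where "a k \<noteq> b k"
    and "\<And>j. (j, k) \<in> (parcs (regulatory_graph S))\<^sup>+ \<Longrightarrow> a j = b j"
    by (rule acyclic_ancestor_minimal) auto
  \<comment> \<open>The states agree on every regulator of \<open>k\<close>, hence
    \<open>S a k = S b k\<close>, which fixedness turns into \<open>a k = b k\<close>.\<close>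
  then show False
    using model_eq_if_agree_on_regulators[of k S a b] assms(2,3) by auto
qed

lemma ex_settling_transition:
  fixes S :: "'n::finite boolean_model"
  assumes "acyclic (parcs (regulatory_graph S))" and "\<Union>P = UNIV" and "S x \<noteq> x"
  obtains y where "(x, y) \<in> parcs (STG P S)" and "settled S x \<subset> settled S y"
proof -
  let ?E = "parcs (regulatory_graph S)"
  have "Upd S x \<noteq> {}" using assms(3) by (simp add: Upd_empty_iff)
  with assms(1) obtain k where k: "k \<in> Upd S x" and
    anc: "\<And>j. (j, k) \<in> ?E\<^sup>+ \<Longrightarrow> j \<notin> Upd S x"
    by (rule acyclic_ancestor_minimal) auto
  obtain J where J: "J \<in> P" "k \<in> J" using assms(2) by blast
  define y where "y = switch x (J \<inter> Upd S x)"
  have "(x, y) \<in> parcs (STG P S)"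
    using J k by (auto simp: in_parcs_STG y_def)
  \<comment> \<open>Only coordinates in \<open>Upd S x\<close> are switched, whatever else
    \<open>J\<close> contains besides \<open>k\<close>.\<close>
  have Sy: "S y j = S x j" if "\<And>i. (i, j) \<in> ?E \<Longrightarrow> i \<notin> Upd S x" for j
    using that unfolding y_def by (intro model_switch_irrelevant) auto
  have stays: "j \<notin> Upd S y" if "j \<notin> Upd S x" "\<And>i. (i, j) \<in> ?E \<Longrightarrow> i \<notin> Upd S x" for j
  proof -
    have "y j = x j" using that(1) by (simp add: y_def switch_def)
    with Sy[OF that(2)] that(1) show ?thesis by (simp add: Upd_def)
  qed
  \<comment> \<open>The switch moves \<open>k\<close> to its target value \<open>S x k\<close>, and
    the target is the same at \<open>y\<close>.\<close>
  have "k \<notin> Upd S y"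
  proof -
    have "y k \<noteq> x k" using J k by (simp add: y_def switch_def)
    moreover have "S y k = S x k" by (intro Sy anc) auto
    ultimately show ?thesis using k by (auto simp: Upd_def)
  qed
  \<comment> \<open>Regulators of an ancestor of \<open>k\<close> are again ancestors of
    \<open>k\<close>, so \<open>stays\<close> applies.\<close>
  moreover have "j \<notin> Upd S y" if "(j, k) \<in> ?E\<^sup>+" for j
    using that anc by (metis stays trancl_into_trancl2)
  ultimately have "k \<in> settled S y"
    by (auto simp: settled_def rtrancl_eq_or_trancl)
  moreover have "k \<notin> settled S x"
    using k by (auto simp: settled_def)
  moreover have "settled S x \<subseteq> settled S y"
  proof
    fix i assume i: "i \<in> settled S x"
    have "j \<notin> Upd S y" if "(j, i) \<in> ?E\<^sup>*" for j
    proof (rule stays)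
      show "j \<notin> Upd S x"
        using i that by (simp add: settled_def)
      show "h \<notin> Upd S x" if "(h, j) \<in> ?E" for h
        using i converse_rtrancl_into_rtrancl[OF that \<open>(j, i) \<in> ?E\<^sup>*\<close>] by (simp add: settled_def)
    qed
    then show "i \<in> settled S y"
      by (simp add: settled_def)
  qed
  ultimately show ?thesis
    using that \<open>(x, y) \<in> parcs (STG P S)\<close> by blast
qed

text \<open>Each settling transition lowers the number of unsettled coordinates. Bounding the length
  by this number, rather than by \<open>n\<close>, lets the induction go through.\<close>

lemma ex_awalk_to_fixed_point:
  fixes S :: "'n::finite boolean_model"
  assumes "acyclic (parcs (regulatory_graph S))" and "\<Union>P = UNIV"
  shows "\<exists>p a. pre_digraph.awalk (with_proj (STG P S)) x p a
    \<and> length p \<le> card (- settled S x) \<and> S a = a"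
proof (induction "card (- settled S x)" arbitrary: x rule: less_induct)
  case less
  interpret wf_digraph "with_proj (STG P S)" by (rule wf_digraph_STG)
  show ?case
  proof (cases "S x = x")
    case True
    moreover have "awalk x [] x" by (simp add: awalk_Nil_iff, simp add: STG_def)
    ultimately show ?thesis by (intro exI[of _ "[]"] exI[of _ x]) simp
  next
    case False
    with assms obtain y where y: "(x, y) \<in> parcs (STG P S)" "settled S x \<subset> settled S y"
      by (rule ex_settling_transition)
    then have card: "card (- settled S y) < card (- settled S x)"
      by (intro psubset_card_mono) auto
    from less[OF this] obtain p a where "awalk y p a" "length p \<le> card (- settled S y)" "S a = a"
      by blast
    moreover from this y have "awalk x ((x, y) # p) a"
      by (simp add: awalk_Cons_iff)
    ultimately show ?thesis
      using card by (intro exI[of _ "(x, y) # p"] exI[of _ a]) auto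
  qed
qed

lemma reachable_STG_from_fixed_point:
  assumes "S a = a" and "a \<rightarrow>\<^sup>*\<^bsub>with_proj (STG P S)\<^esub> v"
  shows "v = a"
proof -
  have "Upd S a = {}" using assms(1) by (simp add: Upd_empty_iff)
  interpret wf_digraph "with_proj (STG P S)" by (rule wf_digraph_STG)
  from assms(2) show ?thesis
    by (induction rule: reachable_induct) (use \<open>Upd S a = {}\<close> in \<open>auto simp: in_parcs_STG\<close>)
qed

text \<open>An attractor is closed under edges, so it contains \<open>a\<close>, which every state
  reaches. Its members are all reachable from \<open>a\<close>, and \<open>a\<close> reaches only
  itself.\<close>

lemma simple_dynamics_STG:
  assumes "S a = a" and reach: "\<And>x. x \<rightarrow>\<^sup>*\<^bsub>with_proj (STG P S)\<^esub> a"
  shows "simple_dynamics (STG P S)"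
proof -
  interpret wf_digraph "with_proj (STG P S)" by (rule wf_digraph_STG)
  have only_a: "v = a" if "a \<rightarrow>\<^sup>*\<^bsub>with_proj (STG P S)\<^esub> v" for v
    using assms(1) that by (rule reachable_STG_from_fixed_point)
  have "A \<in> attractors (STG P S) \<longleftrightarrow> A = {a}" for A
  proof
    assume A: "A \<in> attractors (STG P S)"
    then have scc: "A \<in> sccs_verts"
      and closed: "\<And>u v. (u, v) \<in> parcs (STG P S) \<Longrightarrow> u \<in> A \<Longrightarrow> v \<in> A"
      by (auto simp: attractors_def)
    from scc obtain x where "x \<in> A" by (auto simp: sccs_verts_def)
    from reach[of x] have "a \<in> A"
      by (induction rule: reachable_induct) (use \<open>x \<in> A\<close> closed in auto)
    moreover have "v = a" if "v \<in> A" for v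
      using scc \<open>a \<in> A\<close> that only_a unfolding sccs_verts_def by blast
    ultimately show "A = {a}" by blast
  next
    assume "A = {a}"
    moreover have "{a} \<in> sccs_verts"
      unfolding sccs_verts_def using reach[of a] only_a by blast
    moreover have "(a, v) \<notin> parcs (STG P S)" for v
      using assms(1) by (simp add: in_parcs_STG Upd_empty_iff[THEN iffD2])
    ultimately show "A \<in> attractors (STG P S)"
      by (auto simp: attractors_def)
  qed
  then show ?thesis
    unfolding simple_dynamics_def by blast
qed

theorem theorem4:
  fixes S :: "'n::finite boolean_model"
    and P :: "'n set set"
  assumes "{} \<notin> P"
    and "\<Union>P = UNIV"
    and "\<nexists>p. pre_digraph.cycle (with_proj (regulatory_graph S)) p"
  shows "simple_dynamics (STG P S)
    \<and> (\<exists>!a. S a = a)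
    \<and> (\<forall>x. \<exists>p. pre_digraph.awalk (with_proj (STG P S)) x p (THE a. S a = a)
               \<and> length p \<le> CARD('n))"
proof -
  interpret wf_digraph "with_proj (STG P S)" by (rule wf_digraph_STG)
  have acyclic: "acyclic (parcs (regulatory_graph S))"
    using wf_digraph_regulatory_graph assms(3) by (rule wf_digraph_acyclic)
  note walk = ex_awalk_to_fixed_point[OF acyclic assms(2)]
  \<comment> \<open>A fixed point exists as the end of a walk from an arbitrary state.\<close>
  from walk obtain a where a: "S a = a" by blast
  have unique: "b = a" if "S b = b" for b
    using fixed_point_unique[OF acyclic that a] .
  then have the: "(THE a. S a = a) = a"
    using a by blast
  have short: "\<exists>p. awalk x p a \<and> length p \<le> CARD('n)" for x
  proof -
    from walk[of x] obtain p b where "awalk x p b" "length p \<le> card (- settled S x)" "S b = b"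
      by blast
    moreover have "card (- settled S x) \<le> CARD('n)"
      by (rule card_mono) auto
    ultimately show ?thesis
      \<comment> \<open>The end \<open>b\<close> depends on \<open>x\<close> a priori; uniqueness
        identifies it with \<open>a\<close>.\<close>
      using unique by fastforce
  qed
  have "x \<rightarrow>\<^sup>*\<^bsub>with_proj (STG P S)\<^esub> a" for x
    using short[of x] reachable_awalk by blast
  with a have "simple_dynamics (STG P S)"
    by (rule simple_dynamics_STG)
  moreover have "\<exists>!a. S a = a"
    using a unique by (rule ex1I)
  ultimately show ?thesis
    unfolding the using short by blast
qed

end
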